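(* For the Funk unit disc $(\mathbb{D},F_F)$, the unit speed geodesic $\gamma:[0,\infty)\to\mathbb{D}$ with $\gamma(0)=p\in\mathbb{D}$ and forward hitting point $y\in\partial\mathbb{D}$ is given by $$\gamma(t)=e^{-t}p+(1-e^{-t})y.$$
   Context: $\mathbb{D}=\{x\in\mathbb{R}^2:|x|<1\}$ with the Funk metric $F_F(x,v)=\dfrac{\sqrt{(1-|x|^2)|v|^2+\langle x,v\rangle^2}}{1-|x|^2}+\dfrac{\langle x,v\rangle}{1-|x|^2}$ ($|\cdot|$, $\langle\cdot,\cdot\rangle$ Euclidean). Unit speed means $F_F(\gamma(t),\dot\gamma(t))=1$. The geodesics are straight line segments as point sets; the forward hitting point of the geodesic with initial point $p$ and initial velocity $v\neq0$ is the point $y=p+\dfrac{v}{F_F(p,v)}\in\partial\mathbb{D}$, i.e. the point where the ray from $p$ in direction $v$ meets the unit circle. *)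

theory Defs
  imports "HOL-Analysis.Analysis"
begin

definition funk_metric :: "real^2 \<Rightarrow> real^2 \<Rightarrow> real" where
  "funk_metric x v =
     sqrt ((1 - (norm x)\<^sup>2) * (norm v)\<^sup>2 + (x \<bullet> v)\<^sup>2) / (1 - (norm x)\<^sup>2)
     + (x \<bullet> v) / (1 - (norm x)\<^sup>2)"

text \<open>Derivatives are relative to the parameter interval, hence one-sided at an end point
  that belongs to it.\<close>

definition velocity :: "real set \<Rightarrow> (real \<Rightarrow> 'a::euclidean_space) \<Rightarrow> real \<Rightarrow> 'a" where
  "velocity I \<gamma> t = vector_derivative \<gamma> (at t within I)"

definition C2_curve_on :: "real set \<Rightarrow> (real \<Rightarrow> 'a::euclidean_space) \<Rightarrow> bool" where
  "C2_curve_on I \<gamma> \<longleftrightarrow>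
     \<gamma> differentiable_on I \<and> velocity I \<gamma> differentiable_on I \<and>
     continuous_on I (velocity I (velocity I \<gamma>))"

text \<open>Geodesics of a Finsler metric \<open>F\<close> on an open set \<open>U\<close> are the extremals of the energy
  functional: with \<open>L = F\<^sup>2 / 2\<close>, they satisfy the Euler-Lagrange equations
  \<open>d/dt (\<partial>L/\<partial>v) = \<partial>L/\<partial>x\<close> along \<open>(\<gamma>, \<gamma>')\<close>, here tested on every direction \<open>w\<close>.\<close>

definition finsler_energy ::
    "('a::euclidean_space \<Rightarrow> 'a \<Rightarrow> real) \<Rightarrow> 'a \<Rightarrow> 'a \<Rightarrow> real" where
  "finsler_energy F x v = (F x v)\<^sup>2 / 2"

definition finsler_geodesic ::
    "'a::euclidean_space set \<Rightarrow> ('a \<Rightarrow> 'a \<Rightarrow> real) \<Rightarrow> real set \<Rightarrow> (real \<Rightarrow> 'a) \<Rightarrow> bool" where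
  "finsler_geodesic U F I \<gamma> \<longleftrightarrow>
     \<gamma> ` I \<subseteq> U \<and> C2_curve_on I \<gamma> \<and>
     (\<forall>t\<in>I. \<forall>w.
        ((\<lambda>s. frechet_derivative (\<lambda>v. finsler_energy F (\<gamma> s) v) (at (velocity I \<gamma> s)) w)
          has_real_derivative
          frechet_derivative (\<lambda>x. finsler_energy F x (velocity I \<gamma> t)) (at (\<gamma> t)) w)
        (at t within I))"

definition unit_speed_geodesic ::
    "'a::euclidean_space set \<Rightarrow> ('a \<Rightarrow> 'a \<Rightarrow> real) \<Rightarrow> real set \<Rightarrow> (real \<Rightarrow> 'a) \<Rightarrow> bool" where
  "unit_speed_geodesic U F I \<gamma> \<longleftrightarrow>
     finsler_geodesic U F I \<gamma> \<and> (\<forall>t\<in>I. F (\<gamma> t) (velocity I \<gamma> t) = 1)"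

text \<open>For \<open>p\<close> in the unit disc and \<open>v \<noteq> 0\<close>, the point where the ray from \<open>p\<close> in direction
  \<open>v\<close> meets the unit circle.\<close>

definition forward_hitting_point :: "real^2 \<Rightarrow> real^2 \<Rightarrow> real^2" where
  "forward_hitting_point p v = p + (1 / funk_metric p v) *\<^sub>R v"

end

theory Submission
  imports Defs
begin

text \<open>The Funk metric is characterised by \<open>\<bar>F x + v\<bar> = F\<close>. Differentiating this identity
  gives \<open>\<partial>F/\<partial>x = F \<partial>F/\<partial>v\<close>, and \<open>\<partial>F/\<partial>v\<close> is a positive multiple of \<open>F x + v\<close>. Along a unit
  speed curve the Euler-Lagrange equation thus reads \<open>(\<partial>F/\<partial>v)' = \<partial>F/\<partial>v\<close>, so \<open>\<partial>F/\<partial>v\<close> only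
  changes by the factor \<open>exp t\<close>; the unit vector \<open>\<gamma> + \<gamma>'\<close>, being parallel to it, is constant.
  What remains is the linear equation \<open>\<gamma>' = y - \<gamma>\<close>.\<close>

section \<open>The Funk metric as a root of a quadratic equation\<close>

definition funk_radicand :: "real^2 \<Rightarrow> real^2 \<Rightarrow> real" where
  "funk_radicand x v = (1 - (norm x)\<^sup>2) * (norm v)\<^sup>2 + (x \<bullet> v)\<^sup>2"

lemma funk_metric_alt:
  "funk_metric x v = (sqrt (funk_radicand x v) + x \<bullet> v) / (1 - (norm x)\<^sup>2)"
  by (simp add: funk_metric_def funk_radicand_def add_divide_distrib)

lemma one_minus_norm_square_pos:
  assumes "x \<in> ball (0::real^2) 1"
  shows "0 < 1 - (norm x)\<^sup>2"
  using assms by (simp add: power_less_one_iff)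

lemma funk_radicand_nonneg:
  assumes "x \<in> ball 0 1"
  shows "0 \<le> funk_radicand x v"
  using one_minus_norm_square_pos[OF assms] by (simp add: funk_radicand_def)

lemma funk_radicand_pos:
  assumes "x \<in> ball 0 1" and "v \<noteq> 0"
  shows "0 < funk_radicand x v"
  using one_minus_norm_square_pos[OF assms(1)] assms(2)
  by (simp add: funk_radicand_def add_pos_nonneg)

lemma funk_metric_nonneg:
  assumes "x \<in> ball 0 1"
  shows "0 \<le> funk_metric x v"
proof -
  note pos = one_minus_norm_square_pos[OF assms]
  have "\<bar>x \<bullet> v\<bar> \<le> sqrt (funk_radicand x v)"
    using pos by (intro real_le_rsqrt) (simp add: funk_radicand_def)
  then show ?thesis
    using pos by (simp add: funk_metric_alt)
qed

lemma funk_metric_mult: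
  assumes "x \<in> ball 0 1"
  shows "funk_metric x v * (1 - (norm x)\<^sup>2) = sqrt (funk_radicand x v) + x \<bullet> v"
  using one_minus_norm_square_pos[OF assms] by (simp add: funk_metric_alt)

text \<open>Expanding the square gives the quadratic equation
  \<open>F^2 (1 - |x|^2) - 2 F (x . v) - |v|^2 = 0\<close> in \<open>F\<close>. A quarter of its
  discriminant is \<open>funk_radicand x v\<close>, and the Funk metric is the root taken with the
  positive sign of the square root.\<close>

lemma funk_metric_implicit:
  assumes "x \<in> ball 0 1"
  shows "(funk_metric x v *\<^sub>R x + v) \<bullet> (funk_metric x v *\<^sub>R x + v) = (funk_metric x v)\<^sup>2"
proof -
  define F a b where "F = funk_metric x v" and "a = 1 - (norm x)\<^sup>2" and "b = x \<bullet> v"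
  have a: "a > 0"
    using one_minus_norm_square_pos[OF assms] by (simp add: a_def)
  have "F * a - b = sqrt (funk_radicand x v)"
    using funk_metric_mult[OF assms] by (simp add: F_def a_def b_def)
  then have "(F * a - b)\<^sup>2 = a * (norm v)\<^sup>2 + b\<^sup>2"
    using funk_radicand_nonneg[OF assms] by (simp add: funk_radicand_def a_def b_def)
  then have "a * (F\<^sup>2 * a - 2 * F * b - (norm v)\<^sup>2) = 0"
    by (simp add: power2_eq_square algebra_simps)
  then have "F\<^sup>2 * a - 2 * F * b - (norm v)\<^sup>2 = 0"
    using a by simp
  then show ?thesis
    unfolding F_def[symmetric]
    by (simp add: a_def b_def power2_norm_eq_inner)
      (simp add: power2_eq_square inner_commute algebra_simps)
qed

lemma norm_funk_metric_implicit:
  assumes "x \<in> ball 0 1"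
  shows "norm (funk_metric x v *\<^sub>R x + v) = funk_metric x v"
  using funk_metric_implicit[OF assms] funk_metric_nonneg[OF assms]
  by (simp add: norm_eq_sqrt_inner)

text \<open>The product of the roots of the quadratic equation is
  \<open>- |v|^2 / (1 - |x|^2)\<close>, which is not positive, so at most one root is positive. This
  allows the unit speed of a curve to be checked without handling the square root.\<close>

lemma funk_metric_eqI:
  assumes x: "x \<in> ball 0 1" and c: "c > 0" and "norm (c *\<^sub>R x + v) = c"
  shows "funk_metric x v = c"
proof -
  have "(c *\<^sub>R x + v) \<bullet> (c *\<^sub>R x + v) = c\<^sup>2"
    using assms(3) by (simp add: power2_norm_eq_inner[symmetric])
  then have v: "(norm v)\<^sup>2 = c\<^sup>2 * (1 - (norm x)\<^sup>2) - 2 * c * (x \<bullet> v)"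
    by (simp add: power2_norm_eq_inner) (simp add: power2_eq_square inner_commute algebra_simps)
  have disc: "funk_radicand x v = (c * (1 - (norm x)\<^sup>2) - x \<bullet> v)\<^sup>2"
    unfolding funk_radicand_def v by (simp add: power2_eq_square algebra_simps)
  \<comment> \<open>The square root of \<open>disc\<close> is an absolute value; its sign is settled
    by rewriting this nonnegative sum with \<open>v\<close> as \<open>2 c\<close> times the base of
    the square.\<close>
  have "0 \<le> c\<^sup>2 * (1 - (norm x)\<^sup>2) + (norm v)\<^sup>2"
    using one_minus_norm_square_pos[OF x] by simp
  then have "0 \<le> 2 * c * (c * (1 - (norm x)\<^sup>2) - x \<bullet> v)"
    using v by (simp add: power2_eq_square algebra_simps)
  then have "0 \<le> c * (1 - (norm x)\<^sup>2) - x \<bullet> v"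
    using c by (simp add: zero_le_mult_iff)
  then show ?thesis
    using one_minus_norm_square_pos[OF x] by (simp add: funk_metric_alt disc)
qed

text \<open>The left side is the coefficient of the unknown derivative when the implicit identity is
  differentiated; for nonzero \<open>v\<close> it is positive, so one can divide by it.\<close>

lemma funk_metric_minus_inner:
  assumes "x \<in> ball 0 1"
  shows "funk_metric x v - (funk_metric x v *\<^sub>R x + v) \<bullet> x = sqrt (funk_radicand x v)"
  using funk_metric_mult[OF assms, of v]
  by (simp add: power2_norm_eq_inner inner_commute algebra_simps)

section \<open>Derivatives of the Funk metric and of its energy\<close>

lemma funk_metric_differentiable_velocity:
  assumes "x \<in> ball 0 1" and "v \<noteq> 0"
  shows "(\<lambda>v. funk_metric x v) differentiable (at v)"
proof -
  have "sqrt differentiable at (funk_radicand x v)"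
    using DERIV_real_sqrt[OF funk_radicand_pos[OF assms]] real_differentiable_def by blast
  moreover have "(\<lambda>v. funk_radicand x v) differentiable (at v)"
    unfolding funk_radicand_def power2_norm_eq_inner by (auto intro!: derivative_intros)
  ultimately have "(\<lambda>v. sqrt (funk_radicand x v)) differentiable (at v)"
    using differentiable_chain_at[of "funk_radicand x" v sqrt] by (simp add: o_def)
  then show ?thesis
    unfolding funk_metric_alt divide_inverse by (auto intro!: derivative_intros)
qed

text \<open>As for the velocity, differentiability comes from the explicit formula: \<open>v\<close>
  being nonzero keeps the radicand off the singularity of the square root. The derivative itself is
  then found by implicit differentiation.\<close>

lemma funk_metric_differentiable_point:
  assumes "x \<in> ball 0 1" and "v \<noteq> 0"
  shows "(\<lambda>x. funk_metric x v) differentiable (at x)"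
proof -
  have "sqrt differentiable at (funk_radicand x v)"
    using DERIV_real_sqrt[OF funk_radicand_pos[OF assms]] real_differentiable_def by blast
  moreover have "(\<lambda>x. funk_radicand x v) differentiable (at x)"
    unfolding funk_radicand_def power2_norm_eq_inner by (auto intro!: derivative_intros)
  ultimately have "(\<lambda>x. sqrt (funk_radicand x v)) differentiable (at x)"
    using differentiable_chain_at[of "\<lambda>x. funk_radicand x v" x sqrt] by (simp add: o_def)
  then show ?thesis
    using one_minus_norm_square_pos[OF assms(1)]
    unfolding funk_metric_alt power2_norm_eq_inner by (auto intro!: derivative_intros)
qed

text \<open>With \<open>z = F x + v\<close>, the two sides of \<open>z . z = F^2\<close> have equal
  derivatives, so \<open>z . (D w x + w) = F D w\<close>, that is
  \<open>(F - z . x) D w = z . w\<close>.\<close>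

lemma has_derivative_funk_metric_velocity:
  assumes x: "x \<in> ball 0 1" and v: "v \<noteq> 0"
  shows "((\<lambda>v. funk_metric x v) has_derivative
      (\<lambda>w. (funk_metric x v *\<^sub>R x + v) \<bullet> w / sqrt (funk_radicand x v))) (at v)"
proof -
  obtain D where D: "((\<lambda>v. funk_metric x v) has_derivative D) (at v)"
    using funk_metric_differentiable_velocity[OF assms] by (auto simp: differentiable_def)
  let ?z = "funk_metric x v *\<^sub>R x + v"
  have "((\<lambda>v. (funk_metric x v *\<^sub>R x + v) \<bullet> (funk_metric x v *\<^sub>R x + v)) has_derivative
      (\<lambda>w. 2 * (?z \<bullet> (D w *\<^sub>R x + w)))) (at v)"
    by (rule has_derivative_eq_rhs, (rule derivative_eq_intros D refl)+)
      (simp add: fun_eq_iff inner_commute)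
  moreover have "((\<lambda>v. (funk_metric x v *\<^sub>R x + v) \<bullet> (funk_metric x v *\<^sub>R x + v)) has_derivative
      (\<lambda>w. 2 * (funk_metric x v * D w))) (at v)"
    unfolding funk_metric_implicit[OF x]
    by (rule has_derivative_eq_rhs, (rule derivative_eq_intros D refl)+)
      (simp add: fun_eq_iff)
  ultimately have "(\<lambda>w. 2 * (?z \<bullet> (D w *\<^sub>R x + w))) = (\<lambda>w. 2 * (funk_metric x v * D w))"
    by (rule has_derivative_unique)
  then have eq: "?z \<bullet> (D w *\<^sub>R x + w) = funk_metric x v * D w" for w
    by (simp add: fun_eq_iff)
  have "D w = ?z \<bullet> w / sqrt (funk_radicand x v)" for w
  proof -
    have "D w * sqrt (funk_radicand x v) = ?z \<bullet> w"
      using eq[of w]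
      by (simp add: funk_metric_minus_inner[OF x, symmetric] inner_add_right algebra_simps)
    then show ?thesis
      using funk_radicand_pos[OF assms] by (simp add: field_simps)
  qed
  then have "D = (\<lambda>w. ?z \<bullet> w / sqrt (funk_radicand x v))"
    by (rule ext)
  then show ?thesis
    using D by simp
qed

text \<open>The same argument, except that the product rule for \<open>F x\<close> yields
  \<open>F w\<close> in place of \<open>w\<close>; hence the extra factor \<open>F\<close>.\<close>

lemma has_derivative_funk_metric_point:
  assumes x: "x \<in> ball 0 1" and v: "v \<noteq> 0"
  shows "((\<lambda>x. funk_metric x v) has_derivative
      (\<lambda>w. funk_metric x v * ((funk_metric x v *\<^sub>R x + v) \<bullet> w / sqrt (funk_radicand x v)))) (at x)"
proof -
  obtain D where D: "((\<lambda>x. funk_metric x v) has_derivative D) (at x)"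
    using funk_metric_differentiable_point[OF assms] by (auto simp: differentiable_def)
  let ?z = "funk_metric x v *\<^sub>R x + v"
  have "((\<lambda>x. (funk_metric x v *\<^sub>R x + v) \<bullet> (funk_metric x v *\<^sub>R x + v)) has_derivative
      (\<lambda>w. 2 * (?z \<bullet> (D w *\<^sub>R x + funk_metric x v *\<^sub>R w)))) (at x)"
    by (rule has_derivative_eq_rhs, (rule derivative_eq_intros D refl)+)
      (simp add: fun_eq_iff inner_commute algebra_simps)
  moreover have "((\<lambda>x. (funk_metric x v)\<^sup>2) has_derivative
      (\<lambda>w. 2 * (funk_metric x v * D w))) (at x)"
    by (rule has_derivative_eq_rhs, (rule derivative_eq_intros D refl)+)
      (simp add: fun_eq_iff)
  \<comment> \<open>In this variable the implicit identity is available only inside the disc, so the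
    derivative is transferred on that open set.\<close>
  then have "((\<lambda>x. (funk_metric x v *\<^sub>R x + v) \<bullet> (funk_metric x v *\<^sub>R x + v)) has_derivative
      (\<lambda>w. 2 * (funk_metric x v * D w))) (at x)"
    by (rule has_derivative_transform_within_open[OF _ open_ball x])
      (simp only: funk_metric_implicit)
  ultimately have "(\<lambda>w. 2 * (?z \<bullet> (D w *\<^sub>R x + funk_metric x v *\<^sub>R w))) =
      (\<lambda>w. 2 * (funk_metric x v * D w))"
    by (rule has_derivative_unique)
  then have eq: "?z \<bullet> (D w *\<^sub>R x + funk_metric x v *\<^sub>R w) = funk_metric x v * D w" for w
    by (simp add: fun_eq_iff)
  have "D w = funk_metric x v * (?z \<bullet> w / sqrt (funk_radicand x v))" for w
  proof -
    have "D w * sqrt (funk_radicand x v) = funk_metric x v * (?z \<bullet> w)"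
      using eq[of w]
      by (simp add: funk_metric_minus_inner[OF x, symmetric] inner_add_right algebra_simps)
    then show ?thesis
      using funk_radicand_pos[OF assms] by (simp add: field_simps)
  qed
  then have "D = (\<lambda>w. funk_metric x v * (?z \<bullet> w / sqrt (funk_radicand x v)))"
    by (rule ext)
  then show ?thesis
    using D by simp
qed

lemma frechet_derivative_funk_energy_velocity:
  assumes "x \<in> ball 0 1" and "v \<noteq> 0"
  shows "frechet_derivative (\<lambda>v. finsler_energy funk_metric x v) (at v) w =
      funk_metric x v * ((funk_metric x v *\<^sub>R x + v) \<bullet> w) / sqrt (funk_radicand x v)"
proof -
  have "((\<lambda>v. finsler_energy funk_metric x v) has_derivative
      (\<lambda>w. funk_metric x v * ((funk_metric x v *\<^sub>R x + v) \<bullet> w / sqrt (funk_radicand x v)))) (at v)"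
    unfolding finsler_energy_def
    by (rule has_derivative_eq_rhs,
        (rule derivative_eq_intros has_derivative_funk_metric_velocity[OF assms] refl)+)
      (auto simp: fun_eq_iff)
  from frechet_derivative_at[OF this, symmetric] show ?thesis
    by simp
qed

text \<open>The factor is \<open>F^2\<close> here and \<open>F\<close> for the velocity derivative,
  so the two agree at unit speed.\<close>

lemma frechet_derivative_funk_energy_point:
  assumes "x \<in> ball 0 1" and "v \<noteq> 0"
  shows "frechet_derivative (\<lambda>x. finsler_energy funk_metric x v) (at x) w =
      (funk_metric x v)\<^sup>2 * ((funk_metric x v *\<^sub>R x + v) \<bullet> w) / sqrt (funk_radicand x v)"
proof -
  have "((\<lambda>x. finsler_energy funk_metric x v) has_derivative
      (\<lambda>w. (funk_metric x v)\<^sup>2 * ((funk_metric x v *\<^sub>R x + v) \<bullet> w / sqrt (funk_radicand x v)))) (at x)"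
    unfolding finsler_energy_def
    by (rule has_derivative_eq_rhs,
        (rule derivative_eq_intros has_derivative_funk_metric_point[OF assms] refl)+)
      (auto simp: fun_eq_iff power2_eq_square)
  from frechet_derivative_at[OF this, symmetric] show ?thesis
    by simp
qed

section \<open>One-sided velocities and linear equations on the half-line\<close>

lemma velocity_eqI:
  assumes "(\<gamma> has_vector_derivative d) (at t within {0..})" and "t \<ge> 0"
  shows "velocity {0..} \<gamma> t = d"
proof -
  \<comment> \<open>A connected set with more than one point has no isolated points, so derivatives
    within the half-line are unique, also at 0.\<close>
  have "{0..} \<noteq> {x}" for x :: real
    by (metis atLeast_iff add_increasing2 le_add_same_cancel1 less_add_one less_irrefl order_refl
        singletonD zero_le_one)
  then have "at t within {0..} \<noteq> bot"
    using assms(2) by (simp add: trivial_limit_within connected_imp_perfect)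
  then show ?thesis
    unfolding velocity_def using assms(1) by (rule vector_derivative_within)
qed

lemma has_vector_derivative_velocity:
  assumes "\<gamma> differentiable_on I" and "t \<in> I"
  shows "(\<gamma> has_vector_derivative velocity I \<gamma> t) (at t within I)"
  using assms unfolding velocity_def differentiable_on_def
  by (simp add: vector_derivative_works[symmetric])

text \<open>The integrating factor \<open>exp (- c * t)\<close> makes the product constant on the
  convex half-line.\<close>

lemma linear_ode_exp_solution:
  fixes g :: "real \<Rightarrow> 'a::euclidean_space"
  assumes "\<And>t. t \<ge> 0 \<Longrightarrow> (g has_vector_derivative (c *\<^sub>R g t)) (at t within {0..})" and "t \<ge> 0"
  shows "g t = exp (c * t) *\<^sub>R g 0"
proof -
  have "((\<lambda>t. exp (- c * t) *\<^sub>R g t) has_vector_derivative 0) (at s within {0..})" if "s \<ge> 0" for s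
    by (rule has_vector_derivative_eq_rhs,
        (rule derivative_eq_intros assms(1)[OF that] refl)+) (simp add: algebra_simps)
  then obtain k where k: "\<And>s. s \<in> {0..} \<Longrightarrow> exp (- c * s) *\<^sub>R g s = k"
    using has_vector_derivative_zero_constant[of "{0..}" "\<lambda>s. exp (- c * s) *\<^sub>R g s"]
    by (metis atLeast_iff convex_real_interval(1))
  have "g t = exp (c * t) *\<^sub>R (exp (- c * t) *\<^sub>R g t)"
    by (simp add: exp_minus)
  also have "exp (- c * t) *\<^sub>R g t = g 0"
    using k[of 0] k[of t] assms(2) by simp
  finally show ?thesis .
qed

section \<open>Unit speed geodesics are exponential segments\<close>

lemma funk_metric_zero [simp]: "funk_metric x 0 = 0"
  by (simp add: funk_metric_def)

text \<open>At unit speed the forward hitting point is \<open>p + v\<close>, which is the form in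
  which \<open>y\<close> enters here.\<close>

lemma funk_geodesic_imp_exp_segment:
  assumes geo: "unit_speed_geodesic (ball 0 1) funk_metric {0..} \<gamma>" and t: "t \<ge> 0"
  defines "y \<equiv> \<gamma> 0 + velocity {0..} \<gamma> 0"
  shows "\<gamma> t = exp (- t) *\<^sub>R \<gamma> 0 + (1 - exp (- t)) *\<^sub>R y"
proof -
  \<comment> \<open>At unit speed \<open>Y\<close> is the unit vector \<open>F x + v\<close>, and
    \<open>r\<close> times \<open>Y\<close> is the gradient of the energy in the velocity.\<close>
  define V Y r where "V = velocity {0..} \<gamma>" and "Y = (\<lambda>t. \<gamma> t + V t)"
    and "r = (\<lambda>t. 1 / sqrt (funk_radicand (\<gamma> t) (V t)))"
  note defs = unit_speed_geodesic_def finsler_geodesic_def C2_curve_on_def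
  have ball: "\<gamma> s \<in> ball 0 1" and F: "funk_metric (\<gamma> s) (V s) = 1" if "s \<ge> 0" for s
    using geo that by (auto simp: defs V_def)
  have V0: "V s \<noteq> 0" if "s \<ge> 0" for s
    using F[OF that] by auto
  have r: "r s > 0" if "s \<ge> 0" for s
    using funk_radicand_pos[OF ball V0] that by (simp add: r_def)
  have norm_Y: "norm (Y s) = 1" if "s \<ge> 0" for s
    using norm_funk_metric_implicit[OF ball, of s "V s"] that by (simp add: F Y_def)
  have EL: "((\<lambda>s. r s * (Y s \<bullet> w)) has_real_derivative r s * (Y s \<bullet> w)) (at s within {0..})"
    if s: "s \<ge> 0" for s w
  proof -
    have "((\<lambda>s. frechet_derivative (\<lambda>v. finsler_energy funk_metric (\<gamma> s) v) (at (V s)) w)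
          has_real_derivative
          frechet_derivative (\<lambda>x. finsler_energy funk_metric x (V s)) (at (\<gamma> s)) w)
        (at s within {0..})"
      using geo s by (simp add: defs V_def)
    moreover have "frechet_derivative (\<lambda>v. finsler_energy funk_metric (\<gamma> t) v) (at (V t)) w
        = r t * (Y t \<bullet> w)" if "t \<ge> 0" for t
      using that by (simp add: frechet_derivative_funk_energy_velocity[OF ball V0] F r_def Y_def)
    moreover have "frechet_derivative (\<lambda>x. finsler_energy funk_metric x (V s)) (at (\<gamma> s)) w
        = r s * (Y s \<bullet> w)"
      using s by (simp add: frechet_derivative_funk_energy_point[OF ball V0] F r_def Y_def)
    ultimately show ?thesis
      using s by (auto intro: has_field_derivative_transform_within[OF _ zero_less_one])
  qed
  have Y_const: "Y s = Y 0" if s: "s \<ge> 0" for s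
  proof -
    \<comment> \<open>For each \<open>w\<close> the Euler-Lagrange equation is a scalar equation
      \<open>f' = f\<close>; letting \<open>w\<close> vary recovers the vector
      \<open>r Y\<close>.\<close>
    have "r s * (Y s \<bullet> w) = exp s * (r 0 * (Y 0 \<bullet> w))" for w
      using linear_ode_exp_solution[of "\<lambda>s. r s * (Y s \<bullet> w)" 1 s] EL s
      by (simp add: has_real_derivative_iff_has_vector_derivative)
    then have eq: "r s *\<^sub>R Y s = (exp s * r 0) *\<^sub>R Y 0"
      by (intro vector_eq_rdot[THEN iffD1]) (simp add: mult.assoc)
    then have "norm (r s *\<^sub>R Y s) = norm ((exp s * r 0) *\<^sub>R Y 0)"
      by simp
    \<comment> \<open>Since \<open>Y\<close> has norm 1 and \<open>r\<close> is positive, the norms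
      isolate the growth of \<open>r\<close>; cancelling it leaves \<open>Y\<close>
      constant.\<close>
    then have "r s = exp s * r 0"
      using r[OF s] r[of 0] s by (simp add: norm_Y)
    then show ?thesis
      using eq r[of 0] by simp
  qed
  have y: "y = Y 0"
    by (simp add: y_def Y_def V_def)
  have "((\<lambda>t. \<gamma> t - y) has_vector_derivative (- 1) *\<^sub>R (\<gamma> s - y)) (at s within {0..})"
    if s: "s \<ge> 0" for s
  proof -
    have "(\<gamma> has_vector_derivative V s) (at s within {0..})"
      unfolding V_def using geo s by (intro has_vector_derivative_velocity) (auto simp: defs)
    moreover have "V s = y - \<gamma> s"
      using Y_const[OF s] by (simp add: y Y_def algebra_simps)
    ultimately show ?thesis
      by (auto intro!: derivative_eq_intros)
  qed
  from linear_ode_exp_solution[OF this t] show ?thesis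
    by (simp add: algebra_simps)
qed

section \<open>Exponential segments are unit speed geodesics\<close>

lemma has_vector_derivative_exp_segment:
  fixes p y :: "'a::euclidean_space"
  assumes "\<And>t. t \<ge> 0 \<Longrightarrow> \<gamma> t = exp (- t) *\<^sub>R p + (1 - exp (- t)) *\<^sub>R y" and "s \<ge> 0"
  shows "(\<gamma> has_vector_derivative exp (- s) *\<^sub>R (y - p)) (at s within {0..})"
proof (rule has_vector_derivative_transform)
  show "((\<lambda>t. exp (- t) *\<^sub>R p + (1 - exp (- t)) *\<^sub>R y) has_vector_derivative
      exp (- s) *\<^sub>R (y - p)) (at s within {0..})"
    by (rule has_vector_derivative_eq_rhs, (rule derivative_eq_intros refl)+)
      (simp add: algebra_simps)
qed (use assms in auto)

text \<open>Here the sum of position and velocity is \<open>y\<close> at all times, so every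
  quantity in the Euler-Lagrange equation is explicit. The last two conclusions identify
  \<open>y\<close> as the forward hitting point.\<close>

lemma exp_segment_funk_geodesic:
  fixes p y :: "real^2"
  assumes p: "p \<in> ball 0 1" and y: "y \<in> sphere 0 1"
    and \<gamma>: "\<And>t. t \<ge> 0 \<Longrightarrow> \<gamma> t = exp (- t) *\<^sub>R p + (1 - exp (- t)) *\<^sub>R y"
  shows "unit_speed_geodesic (ball 0 1) funk_metric {0..} \<gamma>"
    and "velocity {0..} \<gamma> 0 = y - p"
    and "funk_metric p (y - p) = 1"
proof -
  define V where "V = velocity {0..} \<gamma>"
  have d\<gamma>: "(\<gamma> has_vector_derivative exp (- s) *\<^sub>R (y - p)) (at s within {0..})" if "s \<ge> 0" for s
    using has_vector_derivative_exp_segment[OF \<gamma> that] .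
  have V: "V s = exp (- s) *\<^sub>R (y - p)" if "s \<ge> 0" for s
    unfolding V_def by (rule velocity_eqI[OF d\<gamma>[OF that] that])
  \<comment> \<open>The velocity is itself an exponential segment, from \<open>y - p\<close> to
    0.\<close>
  have dV: "(V has_vector_derivative exp (- s) *\<^sub>R (p - y)) (at s within {0..})" if "s \<ge> 0" for s
    using has_vector_derivative_exp_segment[of V "y - p" 0, OF _ that] V by simp
  have A: "velocity {0..} V s = exp (- s) *\<^sub>R (p - y)" if "s \<ge> 0" for s
    by (rule velocity_eqI[OF dV[OF that] that])
  have "continuous_on {0..} (velocity {0..} V)"
    by (rule continuous_on_eq[where f = "\<lambda>s. exp (- s) *\<^sub>R (p - y)"])
      (auto simp: A intro!: continuous_intros)
  then have C2: "C2_curve_on {0..} \<gamma>"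
    using d\<gamma> dV unfolding C2_curve_on_def V_def[symmetric] differentiable_on_def
    by (auto intro: differentiableI_vector)
  have ball: "\<gamma> s \<in> ball 0 1" if "s \<ge> 0" for s
  proof -
    have "norm (\<gamma> s) \<le> exp (- s) * norm p + (1 - exp (- s)) * norm y"
      unfolding \<gamma>[OF that] using that by (intro norm_triangle_le) simp
    also have "\<dots> < exp (- s) * 1 + (1 - exp (- s))"
      using p y by simp
    finally show ?thesis
      by simp
  qed
  have sum: "\<gamma> s + V s = y" if "s \<ge> 0" for s
    using that by (simp add: \<gamma> V algebra_simps)
  have F: "funk_metric (\<gamma> s) (V s) = 1" if "s \<ge> 0" for s
    using y that by (intro funk_metric_eqI) (simp_all add: ball[unfolded mem_ball_0] sum)
  have V0: "V s \<noteq> 0" if "s \<ge> 0" for s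
    using F[OF that] by auto
  \<comment> \<open>With \<open>F = 1\<close> and \<open>F x + v = y\<close> the square root equals
    \<open>1 - y . x\<close> at \<open>x\<close> on the curve; inserting the segment and
    \<open>y . y = 1\<close> produces the factor \<open>exp (- s)\<close>.\<close>
  have disc: "sqrt (funk_radicand (\<gamma> s) (V s)) = exp (- s) * (1 - y \<bullet> p)" if "s \<ge> 0" for s
  proof -
    have "y \<bullet> y = 1"
      using y by (simp add: norm_eq_1)
    then show ?thesis
      using funk_metric_minus_inner[OF ball[OF that], of "V s"] that
      by (simp add: F sum) (simp add: \<gamma> algebra_simps)
  qed
  \<comment> \<open>Both energy derivatives are \<open>exp s\<close> times the same constant, and
    the exponential is its own derivative.\<close>
  have EL: "((\<lambda>s. frechet_derivative (\<lambda>v. finsler_energy funk_metric (\<gamma> s) v) (at (V s)) w)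
          has_real_derivative
          frechet_derivative (\<lambda>x. finsler_energy funk_metric x (V t)) (at (\<gamma> t)) w)
        (at t within {0..})" if t: "t \<ge> 0" for t w
  proof -
    have v: "frechet_derivative (\<lambda>v. finsler_energy funk_metric (\<gamma> s) v) (at (V s)) w
        = exp s * (y \<bullet> w / (1 - y \<bullet> p))" if "s \<ge> 0" for s
      using that
      by (simp add: frechet_derivative_funk_energy_velocity[OF ball V0] F sum disc)
        (simp add: exp_minus divide_inverse)
    have x: "frechet_derivative (\<lambda>x. finsler_energy funk_metric x (V t)) (at (\<gamma> t)) w
        = exp t * (y \<bullet> w / (1 - y \<bullet> p))"
      using t
      by (simp add: frechet_derivative_funk_energy_point[OF ball V0] F sum disc)
        (simp add: exp_minus divide_inverse)
    have "((\<lambda>s. exp s * (y \<bullet> w / (1 - y \<bullet> p))) has_real_derivative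
        exp t * (y \<bullet> w / (1 - y \<bullet> p))) (at t within {0..})"
      by (intro DERIV_cmult_right has_field_derivative_at_within[OF DERIV_exp])
    then show ?thesis
      unfolding x by (rule has_field_derivative_transform_within[OF _ zero_less_one])
        (use t v in auto)
  qed
  show "unit_speed_geodesic (ball 0 1) funk_metric {0..} \<gamma>"
    unfolding unit_speed_geodesic_def finsler_geodesic_def V_def[symmetric]
    using ball C2 EL F by auto
  show V00: "velocity {0..} \<gamma> 0 = y - p"
    using V[of 0] by (simp add: V_def)
  show "funk_metric p (y - p) = 1"
    using F[of 0] \<gamma>[of 0] V00 by (simp add: V_def)
qed

theorem proposition4p2:
  fixes p y :: "real^2" and \<gamma> :: "real \<Rightarrow> real^2"
  assumes "p \<in> ball 0 1" and "y \<in> sphere 0 1"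
  shows "(unit_speed_geodesic (ball 0 1) funk_metric {0..} \<gamma> \<and> \<gamma> 0 = p \<and>
            forward_hitting_point p (velocity {0..} \<gamma> 0) = y)
         \<longleftrightarrow> (\<forall>t\<ge>0. \<gamma> t = exp (- t) *\<^sub>R p + (1 - exp (- t)) *\<^sub>R y)"
proof
  assume *: "unit_speed_geodesic (ball 0 1) funk_metric {0..} \<gamma> \<and> \<gamma> 0 = p \<and>
            forward_hitting_point p (velocity {0..} \<gamma> 0) = y"
  then have "funk_metric p (velocity {0..} \<gamma> 0) = 1"
    by (auto simp: unit_speed_geodesic_def)
  with * have "\<gamma> 0 + velocity {0..} \<gamma> 0 = y"
    by (simp add: forward_hitting_point_def)
  with * show "\<forall>t\<ge>0. \<gamma> t = exp (- t) *\<^sub>R p + (1 - exp (- t)) *\<^sub>R y"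
    using funk_geodesic_imp_exp_segment by auto
next
  assume "\<forall>t\<ge>0. \<gamma> t = exp (- t) *\<^sub>R p + (1 - exp (- t)) *\<^sub>R y"
  then show "unit_speed_geodesic (ball 0 1) funk_metric {0..} \<gamma> \<and> \<gamma> 0 = p \<and>
            forward_hitting_point p (velocity {0..} \<gamma> 0) = y"
    using exp_segment_funk_geodesic[OF assms, of \<gamma>] by (simp add: forward_hitting_point_def)
qed

end
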